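(* Let $C=\{m^3:m\in\mathbb Z\}$, let $n!_C$ be its $n$th Bhargava factorial, and for each prime $p$ and $n\ge 1$ put $a_{C,p}(n)=v_p(n!_C)-v_p((n-1)!_C)$. Let $P_3(n)=(3n)(3n-1)(3n-2)$, let $\chi=\chi_{-3}$, let $\ell_\chi(m)=\sum_{p\ne 3}\chi(p)v_p(m)\log p$ for positive integers $m$, and for primes $p\equiv 2\pmod 3$ let $\delta_p(n)=a_{C,p}(n)-v_p(n)$. Then for every integer $n\ge 1$, $$\log\frac{n!_C}{(n-1)!_C}=\frac12\log\bigl(nP_3(n)\bigr)+\varepsilon_C(n),$$ where $$\varepsilon_C(n)=\frac12\bigl(\ell_\chi(P_3(n))-\ell_\chi(n)\bigr)+\sum_{p\equiv 2\,(\mathrm{mod}\ 3)}\delta_p(n)\log p+\Bigl(a_{C,3}(n)-\frac12 v_3(nP_3(n))\Bigr)\log 3.$$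
   Context: Bhargava factorial over $\mathbb Z$: let $S\subseteq\mathbb Z$ be infinite and $p$ a prime. A $p$-ordering of $S$ is a sequence $(a_n)_{n\ge 0}$ in $S$ chosen greedily so that, for every $n$, $a_n$ minimizes $v_p\bigl(\prod_{j=0}^{n-1}(x-a_j)\bigr)$ over $x\in S$. The minimal value $\nu_{S,p}(n)=v_p\bigl(\prod_{j=0}^{n-1}(a_n-a_j)\bigr)$ is independent of the chosen $p$-ordering (Bhargava). The $n$th Bhargava factorial is $n!_S=\prod_p p^{\nu_{S,p}(n)}$ (finitely many nonzero exponents for each $n$), so $v_p(n!_S)=\nu_{S,p}(n)$ and $0!_S=1$. $\chi_{-3}$ is the nontrivial Dirichlet character modulo $3$: $\chi_{-3}(m)=1,-1,0$ according as $m\equiv 1,2,0\pmod 3$. Sums over $p$ run over primes. Known fact (from the literature on $p$-orderings of $d$th powers, Fares–Johnson): for primes $p\equiv 1\pmod 3$ and all $n\ge 0$, $v_p(n!_C)=v_p((3n)!)$. *)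

theory Defs
  imports
    "HOL-Analysis.Infinite_Sum"
    "HOL-Computational_Algebra.Primes"
    "HOL-Library.Extended_Nat"
begin

(* The p-adic valuation on the integers with v_p(0) = \<infinity>. The library's multiplicity
   returns 0 at 0, which would be wrong when minimizing over x \<in> S: a point x = a j
   makes the product vanish and must not count as a minimizer. *)
definition vp :: "nat \<Rightarrow> int \<Rightarrow> enat" where
  "vp p x = (if x = 0 then \<infinity> else enat (multiplicity (int p) x))"

definition p_ordering :: "nat \<Rightarrow> int set \<Rightarrow> (nat \<Rightarrow> int) \<Rightarrow> bool" where
  "p_ordering p S a \<longleftrightarrow>
     (\<forall>n. a n \<in> S \<and> (\<forall>x\<in>S. vp p (\<Prod>j<n. a n - a j) \<le> vp p (\<Prod>j<n. x - a j)))"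

(* For infinite S and prime p, p-orderings exist, the minimal valuations are finite, and
   they do not depend on the p-ordering (Bhargava); so the description is proper. *)
definition nu :: "int set \<Rightarrow> nat \<Rightarrow> nat \<Rightarrow> nat" where
  "nu S p n = (THE k. \<exists>a. p_ordering p S a \<and> vp p (\<Prod>j<n. a n - a j) = enat k)"

(* The product over all primes, restricted to the (finitely many) nontrivial factors. *)
definition bhargava_fact :: "int set \<Rightarrow> nat \<Rightarrow> nat" where
  "bhargava_fact S n = (\<Prod>p\<in>{p. prime p \<and> nu S p n \<noteq> 0}. p ^ nu S p n)"

definition cubes :: "int set" where
  "cubes = {m ^ 3 |m. True}"

(* a_{C,p}(n) and \<delta>_p(n), used for n \<ge> 1 only. *)
definition a_C :: "nat \<Rightarrow> nat \<Rightarrow> int" where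
  "a_C p n = int (multiplicity p (bhargava_fact cubes n))
           - int (multiplicity p (bhargava_fact cubes (n - 1)))"

definition delta :: "nat \<Rightarrow> nat \<Rightarrow> int" where
  "delta p n = a_C p n - int (multiplicity p n)"

(* For n \<ge> 1 the subtractions do not truncate. *)
definition P3 :: "nat \<Rightarrow> nat" where
  "P3 n = (3 * n) * (3 * n - 1) * (3 * n - 2)"

definition chi :: "int \<Rightarrow> int" where
  "chi m = (if m mod 3 = 1 then 1 else if m mod 3 = 2 then -1 else 0)"

(* For m > 0 only finitely many terms are nonzero; a plain sum over the infinite
   set of primes would be 0 by convention. *)
definition ell_chi :: "nat \<Rightarrow> real" where
  "ell_chi m = (\<Sum>\<^sub>\<infinity>p\<in>{p. prime p \<and> p \<noteq> 3}.
      real_of_int (chi (int p)) * real (multiplicity p m) * ln (real p))"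

definition eps_C :: "nat \<Rightarrow> real" where
  "eps_C n =
     1 / 2 * (ell_chi (P3 n) - ell_chi n)
     + (\<Sum>\<^sub>\<infinity>p\<in>{p. prime p \<and> p mod 3 = 2}. real_of_int (delta p n) * ln (real p))
     + (real_of_int (a_C 3 n) - 1 / 2 * real (multiplicity 3 (n * P3 n))) * ln 3"

end

(* The logarithm of n!_C / (n-1)!_C is the sum of a_{C,p}(n) log p. For p = 3 and p = 2 mod 3
   the formula is bookkeeping, so only v_p(n!_C) = v_p((3n)!) for p = 1 mod 3 has content.
   Expanding in the Newton basis of a p-ordering shows that nu_{S,p}(n) is the largest k such
   that some monic integer polynomial of degree n maps S into p^k Z. If f is such a polynomial
   for the cubes, then f(x^3) is monic of degree 3n, which bounds k by v_p((3n)!). Conversely,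
   take h = x (x - 1) ... (x - 3n + 1), whose values are divisible by (3n)!; as Z_p contains a
   primitive cube root of unity w, the average of h(x), h(w x), h(w^2 x) is a monic polynomial
   of degree n in x^3 with values divisible by the same power of p. *)

theory Submission
  imports Defs "HOL-Number_Theory.Pocklington" "HOL-Computational_Algebra.Polynomial"
begin

section \<open>Valuations and existence of \<open>p\<close>-orderings\<close>

lemma enat_le_vp_iff:
  assumes "prime p"
  shows "enat k \<le> vp p x \<longleftrightarrow> int p ^ k dvd x"
proof (cases "x = 0")
  case False
  have "\<not> is_unit (int p)"
    using assms prime_gt_1_nat[of p] by simp
  then show ?thesis
    using False by (simp add: vp_def power_dvd_iff_le_multiplicity)
qed (simp add: vp_def)

lemma vp_mult:
  assumes "prime p"
  shows "vp p (x * y) = vp p x + vp p y"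
proof (cases "x = 0 \<or> y = 0")
  case False
  then show ?thesis
    using assms by (simp add: vp_def prime_elem_multiplicity_mult_distrib)
qed (auto simp: vp_def)

lemma vp_int:
  assumes "prime p" "m > 0"
  shows "vp p (int m) = enat (multiplicity p m)"
proof -
  have "\<not> is_unit p"
    using assms(1) prime_gt_1_nat[of p] by simp
  then have "p ^ k dvd m \<longleftrightarrow> k \<le> multiplicity p m" for k
    using assms(2) by (simp add: power_dvd_iff_le_multiplicity)
  then have "int p ^ k dvd int m \<longleftrightarrow> k \<le> multiplicity p m" for k
    by (metis of_nat_dvd_iff of_nat_power)
  then have "multiplicity (int p) (int m) = multiplicity p m"
    by (intro multiplicity_eqI) (metis order_refl, metis Suc_n_not_le_n)
  then show ?thesis
    using assms(2) by (simp add: vp_def)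
qed

text \<open>The choice at \<open>n\<close> looks only at earlier values, so it can be made along a
  well-founded recursion; a minimizer exists because \<open>enat\<close> is well-ordered.\<close>

lemma exists_p_ordering:
  assumes "S \<noteq> {}"
  shows "\<exists>a. p_ordering p S a"
proof -
  define P where "P = (\<lambda>(f::nat \<Rightarrow> int) n r.
    r \<in> S \<and> (\<forall>x\<in>S. vp p (\<Prod>j<n. r - f j) \<le> vp p (\<Prod>j<n. x - f j)))"
  have "\<exists>f. \<forall>n. P f n (f n)"
  proof (rule dependent_wf_choice[OF wf_less_than])
    fix f g :: "nat \<Rightarrow> int" and n r
    assume "\<And>z. (z, n) \<in> less_than \<Longrightarrow> f z = g z"
    then have "(\<Prod>j<n. x - f j) = (\<Prod>j<n. x - g j)" for x
      by (intro prod.cong) auto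
    then show "P f n r = P g n r"
      by (simp add: P_def)
  next
    fix n and f :: "nat \<Rightarrow> int"
    define V where "V = (\<lambda>x. vp p (\<Prod>j<n. x - f j)) ` S"
    have "(LEAST v. v \<in> V) \<in> V"
      using assms by (intro LeastI_ex[of "\<lambda>v. v \<in> V"]) (auto simp: V_def)
    then obtain r where "r \<in> S" "vp p (\<Prod>j<n. r - f j) = (LEAST v. v \<in> V)"
      by (auto simp: V_def)
    then show "\<exists>r. P f n r"
      by (auto simp: P_def V_def intro!: exI[of _ r] Least_le)
  qed
  then show ?thesis
    by (auto simp: P_def p_ordering_def)
qed

section \<open>Newton expansion along a \<open>p\<close>-ordering\<close>

lemma
  fixes a :: "nat \<Rightarrow> 'a::idom"
  shows degree_prod_linear: "degree (\<Prod>j<n. [:- a j, 1:]) = n"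
    and lead_coeff_prod_linear: "lead_coeff (\<Prod>j<n. [:- a j, 1:]) = 1"
proof -
  show "degree (\<Prod>j<n. [:- a j, 1:]) = n"
    by (subst degree_prod_eq_sum_degree) auto
  show "lead_coeff (\<Prod>j<n. [:- a j, 1:]) = 1"
    by (subst lead_coeff_prod) auto
qed

lemma poly_prod_linear: "poly (\<Prod>j<n. [:- a j, 1:]) x = (\<Prod>j<n. x - a j)"
  for x :: "'a::idom"
  by (simp add: poly_prod)

text \<open>The basis products are monic, so subtracting a multiple of the top one lowers the degree
  without any division. The clause on \<open>c n\<close> later turns monic into top coefficient
  1.\<close>

lemma newton_expansion:
  fixes f :: "'a::idom poly"
  assumes "degree f \<le> n"
  shows "\<exists>c. c n = coeff f n \<and> (\<forall>x. poly f x = (\<Sum>i\<le>n. c i * (\<Prod>j<i. x - a j)))"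
  using assms
proof (induction n arbitrary: f)
  case 0
  then obtain b where "f = [:b:]"
    by (auto elim: degree_eq_zeroE)
  then show ?case
    by (intro exI[of _ "\<lambda>_. b"]) simp
next
  case (Suc n)
  define N where "N = (\<Prod>j<Suc n. [:- a j, 1:])"
  define g where "g = f - smult (coeff f (Suc n)) N"
  have N: "degree N = Suc n" "coeff N (Suc n) = 1"
    using degree_prod_linear[of a "Suc n"] lead_coeff_prod_linear[of a "Suc n"]
    by (simp_all add: N_def del: prod.lessThan_Suc)
  have "degree g \<le> n"
  proof (rule degree_le, intro allI impI)
    fix i assume "i > n"
    then consider "i = Suc n" | "i > Suc n" by linarith
    then show "coeff g i = 0"
      using Suc.prems N by cases (simp_all add: g_def coeff_eq_0)
  qed
  then obtain c where c: "poly g x = (\<Sum>i\<le>n. c i * (\<Prod>j<i. x - a j))" for x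
    using Suc.IH by blast
  define c' where "c' = c(Suc n := coeff f (Suc n))"
  have "poly f x = (\<Sum>i\<le>Suc n. c' i * (\<Prod>j<i. x - a j))" for x
  proof -
    have "poly f x = poly g x + coeff f (Suc n) * poly N x"
      by (simp add: g_def)
    also have "poly N x = (\<Prod>j<Suc n. x - a j)"
      unfolding N_def by (rule poly_prod_linear)
    also have "poly g x = (\<Sum>i\<le>n. c' i * (\<Prod>j<i. x - a j))"
      unfolding c by (intro sum.cong) (auto simp: c'_def)
    finally show ?thesis
      by (simp add: c'_def)
  qed
  then show ?case
    by (intro exI[of _ c']) (simp add: c'_def)
qed

text \<open>Applied to \<open>f = (x - b 0) \<dots> (x - b (n - 1))\<close> for a second \<open>p\<close>-ordering \<open>b\<close>, this yields
  Bhargava's independence theorem: the value at \<open>n\<close> of every \<open>p\<close>-ordering is the largest exponent \<open>k\<close> such that some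
  monic polynomial of degree \<open>n\<close> maps \<open>S\<close> into the multiples of \<open>p ^ k\<close>.\<close>
lemma p_ordering_monic_dvd:
  assumes p: "prime p" and a: "p_ordering p S a"
    and f: "lead_coeff f = 1" "\<And>x. x \<in> S \<Longrightarrow> int p ^ k dvd poly f x"
  shows "int p ^ k dvd (\<Prod>j<degree f. a (degree f) - a j)"
proof -
  obtain c where c: "c (degree f) = coeff f (degree f)"
      "\<And>x. poly f x = (\<Sum>i\<le>degree f. c i * (\<Prod>j<i. x - a j))"
    using newton_expansion[OF order_refl, of f a] by blast
  \<comment> \<open>At \<open>a i\<close> the terms beyond \<open>i\<close> contain the factor
    \<open>a i - a i\<close>. For \<open>m < i\<close>, induction gives divisibility at
    \<open>a m\<close>, and since \<open>a m\<close> minimizes the \<open>m\<close>-th product, it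
    persists at \<open>a i\<close>. As \<open>poly f (a i)\<close> is divisible, so is its remaining
    term, the one at \<open>i\<close>.\<close>
  have "i \<le> degree f \<Longrightarrow> int p ^ k dvd c i * (\<Prod>j<i. a i - a j)" for i
  proof (induction i rule: less_induct)
    case (less i)
    have ai: "a i \<in> S"
      using a by (simp add: p_ordering_def)
    let ?t = "\<lambda>m. c m * (\<Prod>j<m. a i - a j)"
    have "int p ^ k dvd ?t m" if "m < i" for m
    proof -
      have "enat k \<le> vp p (c m) + vp p (\<Prod>j<m. a m - a j)"
        using less.IH[OF that] less.prems that
        by (simp flip: vp_mult[OF p] enat_le_vp_iff[OF p])
      also have "\<dots> \<le> vp p (c m) + vp p (\<Prod>j<m. a i - a j)"
        using a ai by (intro add_mono) (auto simp: p_ordering_def)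
      finally show ?thesis
        by (simp flip: vp_mult[OF p] enat_le_vp_iff[OF p])
    qed
    then have "int p ^ k dvd (\<Sum>m<i. ?t m)"
      by (intro dvd_sum) auto
    moreover have "poly f (a i) = (\<Sum>m\<le>i. ?t m)"
      unfolding c(2)
    proof (rule sum.mono_neutral_right)
      show "\<forall>m\<in>{..degree f} - {..i}. ?t m = 0"
        by (auto simp: prod_zero_iff)
    qed (use less.prems in auto)
    then have "poly f (a i) = (\<Sum>m<i. ?t m) + ?t i"
      by (simp flip: lessThan_Suc_atMost)
    ultimately show ?case
      using f(2)[OF ai] by (simp add: dvd_add_right_iff)
  qed
  from this[of "degree f"] show ?thesis
    using c(1) f(1) by simp
qed

section \<open>Monic polynomials on all of the integers\<close>

lemma fact_dvd_prod_diff: "int (fact n) dvd (\<Prod>j<n. x - int j)"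
  using fact_dvd_pochhammer[of n "x - int n + 1"] falling_fact_pochhammer'[of x n]
  by (simp add: atLeast0LessThan)

lemma prod_diff_eq_fact: "(\<Prod>j<n. int n - int j) = int (fact n)"
proof -
  have "(\<Prod>j<n. int n - int j) = (\<Prod>j<n. int (Suc j))"
    by (rule prod.reindex_bij_witness[of _ "\<lambda>j. n - Suc j" "\<lambda>j. n - Suc j"]) auto
  then show ?thesis
    by (simp add: fact_prod_Suc atLeast0LessThan)
qed

text \<open>The product at \<open>n\<close> is \<open>n!\<close> itself, which divides every product
  of \<open>n\<close> consecutive integers.\<close>

lemma p_ordering_int:
  assumes "prime p"
  shows "p_ordering p UNIV int"
  unfolding p_ordering_def
proof (intro allI conjI ballI)
  fix n and x :: int
  obtain q where "(\<Prod>j<n. x - int j) = int (fact n) * q"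
    using fact_dvd_prod_diff dvdE by blast
  then show "vp p (\<Prod>j<n. int n - int j) \<le> vp p (\<Prod>j<n. x - int j)"
    by (simp add: prod_diff_eq_fact vp_mult[OF assms] del: of_nat_fact)
qed auto

text \<open>The criterion for the whole ring of integers; applied in degree \<open>3 * n\<close>, it
  supplies the upper bound for the cubes.\<close>

lemma monic_dvd_fact:
  assumes "prime p" "lead_coeff f = 1" "\<And>x. int p ^ k dvd poly f x"
  shows "int p ^ k dvd int (fact (degree f))"
  using p_ordering_monic_dvd[OF assms(1) p_ordering_int assms(2), OF assms(1)] assms(3)
  by (simp add: prod_diff_eq_fact del: of_nat_fact)

section \<open>Cube roots of unity modulo prime powers\<close>

lemma exists_primitive_cube_root_mod_prime_power:
  assumes p: "prime p" "p mod 3 = 1"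
  shows "\<exists>w::int. [1 + w + w\<^sup>2 = 0] (mod int p ^ N)"
proof (cases "N = 0")
  case False
  have p1: "p > 1" using p prime_gt_1_nat by blast
  define d where "d = (p - 1) div 3"
  have d: "p - Suc 0 = 3 * d"
    using p p1 by (simp add: d_def) presburger
  obtain g where g: "g \<in> totatives p" "ord p g = p - 1"
    using residue_prime_has_primroot[of p] p by blast
  have "coprime g (p ^ N)"
    using g by (simp add: totatives_def)
  then have "[g ^ totient (p ^ N) = 1] (mod p ^ N)"
    by (rule euler_theorem)
  moreover have "totient (p ^ N) = p ^ (N - 1) * d * 3"
    using p False by (simp add: totient_prime_power d)
  ultimately have u: "[(g ^ (p ^ (N - 1) * d)) ^ 3 = 1] (mod p ^ N)"
    by (simp add: power_mult)
  \<comment> \<open>A primitive root modulo \<open>p\<close>, raised to a third of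
    \<open>totient (p ^ N)\<close>; Euler's theorem then gives \<open>w ^ 3 = 1\<close>.\<close>
  define w where "w = int (g ^ (p ^ (N - 1) * d))"
  have "[w ^ 3 = 1] (mod int p ^ N)"
    using u unfolding w_def by (metis cong_int_iff of_nat_1 of_nat_power)
  then have "int p ^ N dvd w ^ 3 - 1"
    by (simp add: cong_iff_dvd_diff)
  then have *: "int p ^ N dvd (1 + w + w\<^sup>2) * (w - 1)"
    by (simp add: algebra_simps power2_eq_square power3_eq_cube)
  \<comment> \<open>This lets \<open>w - 1\<close> be cancelled from \<open>w ^ 3 - 1\<close>. As
    \<open>g\<close> has order \<open>3 * d\<close> modulo \<open>p\<close>, the opposite would
    force 3 to divide a power of \<open>p\<close>.\<close>
  have "\<not> int p dvd w - 1"
  proof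
    assume "int p dvd w - 1"
    then have "[w = 1] (mod int p)"
      by (simp add: cong_iff_dvd_diff)
    then have "[g ^ (p ^ (N - 1) * d) = 1] (mod p)"
      unfolding w_def by (metis cong_int_iff of_nat_1)
    then have "3 * d dvd p ^ (N - 1) * d"
      using g(2) d ord_divides[of g _ p] by (metis One_nat_def)
    moreover have "d > 0" using d p1 by simp
    ultimately have "3 dvd p ^ (N - 1)" by (metis dvd_times_right_cancel_iff less_numeral_extra(3))
    then have "3 dvd p"
      using prime_dvd_power[of 3 p] by simp
    then show False using p by presburger
  qed
  then have "coprime (int p ^ N) (w - 1)"
    using p by (simp add: prime_imp_coprime)
  with * have "int p ^ N dvd 1 + w + w\<^sup>2"
    by (simp add: coprime_dvd_mult_left_iff)
  then show ?thesis
    by (auto simp: cong_0_iff)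
qed auto

text \<open>Summing \<open>h (w\<^sup>i x)\<close> over the three cube roots of unity extracts the part of \<open>h\<close>
  supported on exponents divisible by 3, up to the \<open>p\<close>-adic unit 3.\<close>
lemma cube_average_dvd:
  fixes h :: "int poly"
  assumes p: "prime p" "p mod 3 = 1"
    and h: "degree h = 3 * n" "\<And>x. int p ^ N dvd poly h x"
  shows "int p ^ N dvd (\<Sum>k\<le>n. coeff h (3 * k) * (x ^ 3) ^ k)"
proof -
  let ?P = "int p ^ N"
  obtain w :: int where w: "[1 + w + w\<^sup>2 = 0] (mod ?P)"
    using exists_primitive_cube_root_mod_prime_power[OF p] by blast
  have "?P dvd 1 + w + w\<^sup>2"
    using w by (simp add: cong_0_iff)
  then have "?P dvd (1 + w + w\<^sup>2) * (w - 1)" by simp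
  then have w3: "[w ^ 3 = 1] (mod ?P)"
    by (simp add: cong_iff_dvd_diff algebra_simps power2_eq_square power3_eq_cube)
  \<comment> \<open>Orthogonality of the cube roots of unity; by \<open>w3\<close> only the residue
    of \<open>i\<close> modulo 3 matters.\<close>
  have cyc: "[1 + w ^ i + (w\<^sup>2) ^ i = (if 3 dvd i then 3 else 0)] (mod ?P)" for i
  proof -
    define q where "q = i div 3"
    have w3q: "[w ^ (3 * q) = 1] (mod ?P)"
      using cong_pow[OF w3, of q] by (simp add: power_mult)
    have red: "[1 + w ^ i + (w\<^sup>2) ^ i = 1 + w ^ r + (w\<^sup>2) ^ r] (mod ?P)" if "i = 3 * q + r" for r
    proof -
      have 1: "[w ^ i = w ^ r] (mod ?P)"
        using cong_mult[OF w3q cong_refl, of "w ^ r"] by (simp add: that power_add)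
      have "[(w ^ i)\<^sup>2 = (w ^ r)\<^sup>2] (mod ?P)"
        using 1 by (rule cong_pow)
      then have "[(w\<^sup>2) ^ i = (w\<^sup>2) ^ r] (mod ?P)"
        by (simp add: mult.commute flip: power_mult)
      then show ?thesis
        using 1 by (intro cong_add) auto
    qed
    consider "i = 3 * q + 0" | "i = 3 * q + 1" | "i = 3 * q + 2"
      unfolding q_def by linarith
    then show ?thesis
    proof cases
      case 1
      then show ?thesis using red[OF 1] by simp
    next
      case 2
      then have "\<not> 3 dvd i" by presburger
      then show ?thesis using cong_trans[OF red[OF 2], of 0] w by simp
    next
      case 3
      then have "\<not> 3 dvd i" by presburger
      \<comment> \<open>Here the sum is \<open>1 + w^2 + w^4\<close>, and \<open>w^4 = w\<close>
        reduces it to \<open>1 + w + w^2\<close>.\<close>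
      have "[w ^ 3 * w = 1 * w] (mod ?P)"
        using w3 by (rule cong_scalar_right)
      then have "[1 + w\<^sup>2 + (w\<^sup>2)\<^sup>2 = 1 + w\<^sup>2 + w] (mod ?P)"
        by (intro cong_add cong_refl) (simp add: eval_nat_numeral mult_ac)
      then have "[1 + w\<^sup>2 + (w\<^sup>2)\<^sup>2 = 0] (mod ?P)"
        using cong_trans[of _ "1 + w\<^sup>2 + w" ?P 0] w by (simp add: add_ac)
      then show ?thesis using cong_trans[OF red[OF 3], of 0] \<open>\<not> 3 dvd i\<close> by simp
    qed
  qed
  have "poly h x + poly h (w * x) + poly h (w\<^sup>2 * x)
      = (\<Sum>i\<le>3 * n. coeff h i * x ^ i * (1 + w ^ i + (w\<^sup>2) ^ i))"
    by (simp add: poly_altdef h(1) sum.distrib power_mult_distrib algebra_simps)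
  also have "[\<dots> = (\<Sum>i\<le>3 * n. coeff h i * x ^ i * (if 3 dvd i then 3 else 0))] (mod ?P)"
    by (intro cong_sum cong_mult cong_refl cyc)
  also have "(\<Sum>i\<le>3 * n. coeff h i * x ^ i * (if 3 dvd i then 3 else 0))
      = (\<Sum>i\<in>(*) 3 ` {..n}. coeff h i * x ^ i * (if 3 dvd i then 3 else 0))"
    by (rule sum.mono_neutral_right) (auto simp: image_iff)
  also have "\<dots> = 3 * (\<Sum>k\<le>n. coeff h (3 * k) * (x ^ 3) ^ k)"
    by (subst sum.reindex) (auto simp: inj_on_def sum_distrib_left mult_ac simp flip: power_mult)
  finally have "[poly h x + poly h (w * x) + poly h (w\<^sup>2 * x)
      = 3 * (\<Sum>k\<le>n. coeff h (3 * k) * (x ^ 3) ^ k)] (mod ?P)" .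
  moreover have "?P dvd poly h x + poly h (w * x) + poly h (w\<^sup>2 * x)"
    by (intro dvd_add h(2))
  ultimately have *: "?P dvd 3 * (\<Sum>k\<le>n. coeff h (3 * k) * (x ^ 3) ^ k)"
    using cong_dvd_iff[of _ _ ?P] cong_0_iff cong_sym cong_trans by blast
  have "\<not> p dvd 3"
    using p primes_dvd_imp_eq[of p 3] by auto
  then have "coprime p 3"
    using p by (simp add: prime_imp_coprime)
  then have "coprime (int p) 3"
    by (metis coprime_int_iff of_nat_numeral)
  then show ?thesis
    using * by (simp add: coprime_dvd_mult_right_iff)
qed

section \<open>Valuations for the cubes at primes 1 modulo 3\<close>

lemma p_ordering_cubes_vp:
  assumes p: "prime p" "p mod 3 = 1" and a: "p_ordering p cubes a"
  shows "vp p (\<Prod>j<n. a n - a j) = vp p (int (fact (3 * n)))"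
proof (rule antisym)
  define D where "D = (\<Prod>j<n. a n - a j)"
  have upper: "int p ^ k dvd int (fact (3 * n))" if "int p ^ k dvd D" for k
  proof -
    \<comment> \<open>\<open>F\<close> is the product of the \<open>x ^ 3 - a j\<close>. Minimality
      of \<open>a n\<close> over the cubes makes all its values at least as divisible by
      \<open>p\<close> as \<open>D\<close>.\<close>
    define F where "F = pcompose (\<Prod>j<n. [:- a j, 1:]) (monom 1 3)"
    have "degree F = 3 * n"
      by (simp add: F_def degree_pcompose degree_monom_eq degree_prod_linear)
    moreover have "lead_coeff F = 1"
      unfolding F_def
      by (subst lead_coeff_comp) (simp_all add: degree_monom_eq lead_coeff_prod_linear)
    ultimately have F: "degree F = 3 * n" "lead_coeff F = 1"
      by blast+
    have "int p ^ k dvd poly F x" for x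
    proof -
      have "vp p D \<le> vp p (\<Prod>j<n. x ^ 3 - a j)"
        using a by (auto simp: p_ordering_def D_def cubes_def)
      then have "enat k \<le> vp p (\<Prod>j<n. x ^ 3 - a j)"
        using that by (meson enat_le_vp_iff order_trans p(1))
      then show ?thesis
        by (simp add: F_def poly_pcompose poly_monom poly_prod enat_le_vp_iff[OF p(1)])
    qed
    then show ?thesis
      using monic_dvd_fact[OF p(1) F(2)] F(1) by (simp del: of_nat_fact)
  qed
  have lower: "int p ^ k dvd D" if k: "int p ^ k dvd int (fact (3 * n))" for k
  proof -
    define h where "h = (\<Prod>j<3 * n. [:- int j, 1:])"
    have h: "degree h = 3 * n" "coeff h (3 * n) = 1"
      using degree_prod_linear[of int "3 * n"] lead_coeff_prod_linear[of int "3 * n"]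
      by (simp_all add: h_def)
    have hk: "int p ^ k dvd poly h x" for x
      using k fact_dvd_prod_diff[of "3 * n" x] dvd_trans unfolding h_def poly_prod_linear by blast
    \<comment> \<open>With every third coefficient of \<open>h\<close>, \<open>f\<close> at
      \<open>x ^ 3\<close> is the averaged part of \<open>h\<close>. The index \<open>3 * n\<close>
      is among those kept, so \<open>f\<close> is monic.\<close>
    define f where "f = (\<Sum>i\<le>n. monom (coeff h (3 * i)) i)"
    have cf: "coeff f i = (if i \<le> n then coeff h (3 * i) else 0)" for i
      by (simp add: f_def coeff_sum)
    have f: "degree f = n" "lead_coeff f = 1"
    proof -
      show "degree f = n"
        using h(2) by (intro antisym degree_le le_degree) (auto simp: cf)
      then show "lead_coeff f = 1" using h(2) by (simp add: cf)
    qed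
    have "int p ^ k dvd poly f x" if "x \<in> cubes" for x
    proof -
      obtain m where "x = m ^ 3"
        using \<open>x \<in> cubes\<close> by (auto simp: cubes_def)
      then show ?thesis
        using cube_average_dvd[OF p h(1) hk, of m]
        by (simp add: f_def poly_sum poly_monom)
    qed
    then show ?thesis
      using p_ordering_monic_dvd[OF p(1) a f(2)] f(1) by (simp add: D_def)
  qed
  \<comment> \<open>Finite exponents suffice even for infinite valuations: if \<open>v\<close> is a
    finite \<open>m\<close>, testing \<open>Suc m\<close> excludes \<open>u > m\<close>.\<close>
  have le: "u \<le> v" if "\<And>k. enat k \<le> u \<Longrightarrow> enat k \<le> v" for u v :: enat
  proof (cases v)
    case (enat m)
    then show ?thesis
      using that[of "Suc m"] that[of m] by (cases u) (auto simp: Suc_le_eq intro: leI)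
  qed simp
  show "vp p (\<Prod>j<n. a n - a j) \<le> vp p (int (fact (3 * n)))"
    by (rule le) (use upper in \<open>simp only: enat_le_vp_iff[OF p(1)] D_def\<close>)
  show "vp p (int (fact (3 * n))) \<le> vp p (\<Prod>j<n. a n - a j)"
    by (rule le) (use lower in \<open>simp only: enat_le_vp_iff[OF p(1)] D_def\<close>)
qed

section \<open>Bhargava factorials of the cubes\<close>

lemma nu_eqI:
  assumes "S \<noteq> {}" "\<And>a. p_ordering p S a \<Longrightarrow> vp p (\<Prod>j<n. a n - a j) = enat k"
  shows "nu S p n = k"
proof -
  obtain a where "p_ordering p S a"
    using exists_p_ordering[OF assms(1)] by blast
  then show ?thesis
    unfolding nu_def using assms(2) by (intro the_equality) (blast, metis enat.inject)
qed

lemma cubes_nonempty: "cubes \<noteq> {}"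
  by (auto simp: cubes_def)

lemma nu_cubes:
  assumes "prime p" "p mod 3 = 1"
  shows "nu cubes p n = multiplicity p (fact (3 * n))"
proof (rule nu_eqI[OF cubes_nonempty])
  fix a assume "p_ordering p cubes a"
  then show "vp p (\<Prod>j<n. a n - a j) = enat (multiplicity p (fact (3 * n)))"
    using p_ordering_cubes_vp[OF assms, of a n]
    by (simp add: vp_int[OF assms(1)] del: of_nat_fact)
qed

text \<open>Pigeonhole: the cubes of \<open>0, ..., n\<close> are distinct modulo \<open>p\<close>,
  so one of them avoids the residues of the \<open>n\<close> earlier terms and makes the product
  prime to \<open>p\<close>.\<close>

lemma nu_cubes_eq_0:
  assumes p: "prime p" "p > n ^ 3"
  shows "nu cubes p n = 0"
proof (rule nu_eqI[OF cubes_nonempty])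
  fix a assume a: "p_ordering p cubes a"
  define R C where "R = (\<lambda>i. int (i ^ 3) mod int p) ` {..n}"
    and "C = (\<lambda>j. a j mod int p) ` {..<n}"
  have "inj_on (\<lambda>i. int (i ^ 3) mod int p) {..n}"
  proof (rule inj_onI)
    fix i j assume ij: "i \<in> {..n}" "j \<in> {..n}" "int (i ^ 3) mod int p = int (j ^ 3) mod int p"
    then have "i ^ 3 < p" "j ^ 3 < p"
      using p(2) by (meson atMost_iff order_le_less_trans power_mono zero_le)+
    then show "i = j"
      using ij(3) by (simp add: power_eq_iff_eq_base flip: of_nat_power of_nat_mod)
  qed
  then have "card R = Suc n"
    by (simp add: R_def card_image)
  moreover have "card C \<le> n"
    using card_image_le[of "{..<n}" "\<lambda>j. a j mod int p"] by (simp add: C_def)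
  moreover have "finite C"
    by (simp add: C_def)
  ultimately have "\<not> R \<subseteq> C"
    using card_mono[of C R] by linarith
  then obtain i where "int (i ^ 3) mod int p \<notin> C"
    by (auto simp: R_def)
  then have i: "int (i ^ 3) mod int p \<noteq> a j mod int p" if "j < n" for j
    using that by (auto simp: C_def)
  then have "\<not> int p dvd (\<Prod>j<n. int i ^ 3 - a j)"
    using p by (auto simp: prime_dvd_prod_iff mod_eq_dvd_iff)
  moreover have "vp p (\<Prod>j<n. a n - a j) \<le> vp p (\<Prod>j<n. int i ^ 3 - a j)"
    using a by (auto simp: p_ordering_def cubes_def)
  ultimately have "\<not> enat 1 \<le> vp p (\<Prod>j<n. a n - a j)"
    using enat_le_vp_iff[OF p(1), of 1] by (metis order_trans power_one_right)
  then show "vp p (\<Prod>j<n. a n - a j) = enat 0"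
    by (cases "vp p (\<Prod>j<n. a n - a j)") auto
qed

text \<open>Over an infinite index set the product in \<open>bhargava_fact\<close> would be 1 by
  convention.\<close>

lemma finite_nu_cubes: "finite {p. prime p \<and> nu cubes p n \<noteq> 0}"
proof (rule finite_subset)
  show "{p. prime p \<and> nu cubes p n \<noteq> 0} \<subseteq> {..n ^ 3}"
    using nu_cubes_eq_0 not_less by blast
qed simp

lemma bhargava_fact_pos: "bhargava_fact cubes n > 0"
  unfolding bhargava_fact_def by (intro prod_pos) (auto dest: prime_gt_0_nat)

lemma multiplicity_bhargava_fact:
  assumes "prime p"
  shows "multiplicity p (bhargava_fact cubes n) = nu cubes p n"
  unfolding bhargava_fact_def
  by (subst multiplicity_prod_prime_powers[OF finite_nu_cubes _ assms]) (use assms in simp_all)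

lemma P3_pos: "n \<ge> 1 \<Longrightarrow> P3 n > 0"
  by (simp add: P3_def)

text \<open>\<open>P3 n\<close> is the quotient of \<open>(3n)!\<close> by
  \<open>(3n - 3)!\<close>.\<close>

lemma a_C_eq:
  assumes "prime p" "p mod 3 = 1" "n \<ge> 1"
  shows "a_C p n = int (multiplicity p (P3 n))"
proof -
  obtain m where m: "n = Suc m"
    using assms(3) by (cases n) auto
  have "fact (3 * n) = P3 n * (fact (3 * (n - 1)) :: nat)"
    by (simp add: m P3_def numeral_3_eq_3 algebra_simps)
  then have "multiplicity p (fact (3 * n)) =
      multiplicity p (P3 n) + multiplicity p (fact (3 * (n - 1)) :: nat)"
    using assms P3_pos[of n] by (simp add: prime_elem_multiplicity_mult_distrib)
  then show ?thesis
    using assms by (simp add: a_C_def multiplicity_bhargava_fact nu_cubes)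
qed

section \<open>Logarithms as sums over primes\<close>

lemma ln_eq_sum_multiplicity:
  assumes "m > 0" "finite Q" "prime_factors m \<subseteq> Q" "\<And>p. p \<in> Q \<Longrightarrow> prime p"
  shows "ln (real m) = (\<Sum>p\<in>Q. real (multiplicity p m) * ln (real p))"
proof -
  have "m = (\<Prod>p\<in>Q. p ^ multiplicity p m)"
    by (rule trans[OF prime_factorization_nat[OF assms(1)] prod.mono_neutral_left])
      (use assms in \<open>auto simp: prime_factors_multiplicity\<close>)
  then have "ln (real m) = ln (\<Prod>p\<in>Q. real p ^ multiplicity p m)"
    by (metis (no_types, lifting) of_nat_power of_nat_prod prod.cong)
  also have "\<dots> = (\<Sum>p\<in>Q. ln (real p ^ multiplicity p m))"
    using assms by (intro ln_prod) (auto dest: prime_gt_0_nat)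
  also have "\<dots> = (\<Sum>p\<in>Q. real (multiplicity p m) * ln (real p))"
    using assms by (intro sum.cong) (auto dest: prime_gt_0_nat simp: ln_realpow)
  finally show ?thesis .
qed

text \<open>Brings sums over different sets of primes to one common finite index set, where they can
  be compared termwise.\<close>

lemma infsum_eq_sum_if:
  fixes f :: "'a \<Rightarrow> real"
  assumes "finite Q" "\<And>x. x \<in> A \<Longrightarrow> x \<notin> Q \<Longrightarrow> f x = 0"
  shows "infsum f A = (\<Sum>x\<in>Q. if x \<in> A then f x else 0)"
proof -
  have "infsum f A = infsum (\<lambda>x. if x \<in> A then f x else 0) Q"
    using assms by (intro infsum_cong_neutral) auto
  then show ?thesis
    using assms(1) by simp
qed

theorem proposition7p3:
  fixes n :: nat
  assumes "n \<ge> 1"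
  shows "ln (real (bhargava_fact cubes n) / real (bhargava_fact cubes (n - 1)))
         = 1 / 2 * ln (real (n * P3 n)) + eps_C n"
proof -
  define B B' where "B = bhargava_fact cubes n" and "B' = bhargava_fact cubes (n - 1)"
  have pos: "B > 0" "B' > 0" "P3 n > 0" "n > 0"
    using bhargava_fact_pos P3_pos assms by (auto simp: B_def B'_def)
  \<comment> \<open>All primes that can contribute; 3 is added so that the separate
    \<open>ln 3\<close> term is always a summand.\<close>
  define Q where "Q = insert 3 (prime_factors (B * B' * n * P3 n))"
  have Q: "finite Q" "3 \<in> Q" "\<And>p. p \<in> Q \<Longrightarrow> prime p"
    by (auto simp: Q_def)
  have sub: "prime_factors m \<subseteq> Q" if "m dvd B * B' * n * P3 n" for m
    using dvd_prime_factors[OF _ that] pos by (auto simp: Q_def)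
  have subs: "prime_factors B \<subseteq> Q" "prime_factors B' \<subseteq> Q"
    "prime_factors n \<subseteq> Q" "prime_factors (P3 n) \<subseteq> Q" "prime_factors (n * P3 n) \<subseteq> Q"
    by (intro sub; simp add: mult.assoc)+
  have mult0: "multiplicity p m = 0" if "prime p" "p \<notin> Q" "prime_factors m \<subseteq> Q" for p m
    using that by (auto simp: prime_factors_multiplicity)
  have aC: "a_C p n = int (multiplicity p B) - int (multiplicity p B')" for p
    by (simp add: a_C_def B_def B'_def)
  have ell: "ell_chi m = (\<Sum>p\<in>Q. real_of_int (chi (int p)) * real (multiplicity p m) * ln (real p))"
    if "prime_factors m \<subseteq> Q" for m
    unfolding ell_chi_def using that Q(3)
    by (subst infsum_eq_sum_if[OF Q(1)]) (auto intro!: sum.cong simp: mult0 chi_def)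
  have dl: "(\<Sum>\<^sub>\<infinity>p\<in>{p. prime p \<and> p mod 3 = 2}. real_of_int (delta p n) * ln (real p))
     = (\<Sum>p\<in>Q. if p mod 3 = 2 then real_of_int (delta p n) * ln (real p) else 0)"
    using subs Q(3)
    by (subst infsum_eq_sum_if[OF Q(1)]) (auto intro!: sum.cong simp: mult0 delta_def aC)
  have three: "(real_of_int (a_C 3 n) - 1 / 2 * real (multiplicity 3 (n * P3 n))) * ln 3
    = (\<Sum>p\<in>Q. if p = 3 then
        (real_of_int (a_C p n) - 1 / 2 * real (multiplicity p (n * P3 n))) * ln (real p) else 0)"
    using Q by (subst sum.delta) auto
  have "ln (real B / real B') = (\<Sum>p\<in>Q. real_of_int (a_C p n) * ln (real p))"
    using pos subs Q
    by (simp add: ln_div ln_eq_sum_multiplicity[of _ Q] aC algebra_simps flip: sum_subtractf)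
  also have "\<dots> = (\<Sum>p\<in>Q. 1 / 2 * (real (multiplicity p (n * P3 n)) * ln (real p))
     + (1 / 2 * (real_of_int (chi (int p)) * real (multiplicity p (P3 n)) * ln (real p)
                 - real_of_int (chi (int p)) * real (multiplicity p n) * ln (real p))
     + (if p mod 3 = 2 then real_of_int (delta p n) * ln (real p) else 0)
     + (if p = 3 then
        (real_of_int (a_C p n) - 1 / 2 * real (multiplicity p (n * P3 n))) * ln (real p) else 0)))"
  proof (rule sum.cong[OF refl])
    fix p assume "p \<in> Q"
    then have p: "prime p" by (rule Q(3))
    then have split: "multiplicity p (n * P3 n) = multiplicity p n + multiplicity p (P3 n)"
      using pos by (simp add: prime_elem_multiplicity_mult_distrib)
    have "3 dvd p \<longleftrightarrow> p = 3"
      using primes_dvd_imp_eq[of 3 p] p by auto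
    then have "p = 3 \<or> p mod 3 = 1 \<or> p mod 3 = 2"
      by presburger
    \<comment> \<open>For residue 1, \<open>chi\<close> is 1, the halves of \<open>v_p(n)\<close>
      cancel and \<open>v_p(P3 n)\<close> remains. For residue 2, \<open>chi\<close> is -1,
      \<open>v_p(n)\<close> remains and \<open>delta\<close> corrects it. At 3, \<open>chi\<close>
      is 0 and the last term replaces the half valuation by \<open>a_C\<close>.\<close>
    then consider "p = 3" | "p mod 3 = 1" | "p mod 3 = 2"
      by blast
    then show "real_of_int (a_C p n) * ln (real p) =
      1 / 2 * (real (multiplicity p (n * P3 n)) * ln (real p))
     + (1 / 2 * (real_of_int (chi (int p)) * real (multiplicity p (P3 n)) * ln (real p)
                 - real_of_int (chi (int p)) * real (multiplicity p n) * ln (real p))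
     + (if p mod 3 = 2 then real_of_int (delta p n) * ln (real p) else 0)
     + (if p = 3 then
        (real_of_int (a_C p n) - 1 / 2 * real (multiplicity p (n * P3 n))) * ln (real p) else 0))"
    proof cases
      case 1
      then show ?thesis by (simp add: chi_def algebra_simps)
    next
      case 2
      then have "int p mod 3 = 1" by presburger
      then have "chi (int p) = 1" "p \<noteq> 3" by (auto simp: chi_def)
      then show ?thesis
        using 2 a_C_eq[OF p 2 assms] by (simp add: split algebra_simps)
    next
      case 3
      then have "int p mod 3 = 2" by presburger
      then have "chi (int p) = -1" "p \<noteq> 3" by (auto simp: chi_def)
      then show ?thesis
        using 3 by (simp add: split delta_def algebra_simps)
    qed
  qed
  also have "\<dots> = 1 / 2 * ln (real (n * P3 n)) + eps_C n"
    using pos subs Q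
    by (simp add: eps_C_def ell dl three ln_eq_sum_multiplicity[of "n * P3 n" Q]
        sum.distrib sum_subtractf del: of_nat_mult flip: sum_divide_distrib)
  finally show ?thesis
    by (simp add: B_def B'_def)
qed

end
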